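(* Let $A$ be a commutative Noetherian ring containing a field $K$ of characteristic zero, let $m\ge 1$, and let $M=\bigoplus_{n\in\mathbb{Z}}M_n$ be a generalized Eulerian $A_m(A)$-module. Then: (I) The following conditions are equivalent: (a) $M_n\neq 0$ for infinitely many $n<0$; (b) there exists $r$ such that $M_n\neq 0$ for all $n\le r$; (c) $M_n\neq 0$ for all $n\le -m$; (d) $M_s\neq 0$ for some $s\le -m$. (II) The following conditions are equivalent: (a) $M_n\neq 0$ for infinitely many $n\ge 0$; (b) there exists $s$ such that $M_n\neq 0$ for all $n\ge s$; (c) $M_n\neq 0$ for all $n\ge 0$; (d) $M_t\neq 0$ for some $t\ge 0$.
   Context: $A_m(A)=A\otimes_K A_m(K)=A\langle X_1,\ldots,X_m,\partial_1,\ldots,\partial_m\rangle$ is the $m$-th Weyl algebra over $A$: elements of $A$ are central, the $X_i$ commute with each other, the $\partial_i$ commute with each other, and $\partial_iX_j-X_j\partial_i=\delta_{ij}$. It is $\mathbb{Z}$-graded by $\deg z=0$ for $z\in A$, $\deg X_i=1$, $\deg\partial_i=-1$. Modules are left modules. The Euler operator is $\mathcal{E}_m=\sum_{i=1}^m X_i\partial_i$. A graded $A_m(A)$-module $M$ is generalized Eulerian if for each homogeneous $y\in M$ of degree $|y|$ there is a positive integer $a$ (depending on $y$) with $(\mathcal{E}_m-|y|)^a\cdot y=0$. *)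

theory Defs
  imports "HOL-Algebra.Algebra"
begin

section \<open>Free associative algebras\<close>

text \<open>An element of the free algebra over \<open>R\<close> on the alphabet \<open>L\<close> is the finitely supported
  function sending a word in \<open>L\<close> to its coefficient. The coefficients commute with
  the letters, so elements of a commutative \<open>R\<close> are central.\<close>

definition conv :: "('a, 'x) ring_scheme \<Rightarrow> ('l list \<Rightarrow> 'a) \<Rightarrow> ('l list \<Rightarrow> 'a) \<Rightarrow> 'l list \<Rightarrow> 'a"
  where "conv R f g = (\<lambda>w. \<Oplus>\<^bsub>R\<^esub>i\<in>{..length w}. f (take i w) \<otimes>\<^bsub>R\<^esub> g (drop i w))"

definition free_algebra :: "('a, 'x) ring_scheme \<Rightarrow> 'l set \<Rightarrow> ('l list \<Rightarrow> 'a) ring"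
  where "free_algebra R L =
    \<lparr>carrier = {f. (\<forall>w. f w \<in> carrier R) \<and> finite {w. f w \<noteq> \<zero>\<^bsub>R\<^esub>} \<and>
                   (\<forall>w. f w \<noteq> \<zero>\<^bsub>R\<^esub> \<longrightarrow> set w \<subseteq> L)},
     monoid.mult = conv R,
     one = (\<lambda>w. if w = [] then \<one>\<^bsub>R\<^esub> else \<zero>\<^bsub>R\<^esub>),
     ring.zero = (\<lambda>w. \<zero>\<^bsub>R\<^esub>),
     add = (\<lambda>f g w. f w \<oplus>\<^bsub>R\<^esub> g w)\<rparr>"

definition letter :: "('a, 'x) ring_scheme \<Rightarrow> 'l \<Rightarrow> 'l list \<Rightarrow> 'a"
  where "letter R a = (\<lambda>w. if w = [a] then \<one>\<^bsub>R\<^esub> else \<zero>\<^bsub>R\<^esub>)"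

context ring
begin

lemma conv_closed:
  assumes "\<And>w. f w \<in> carrier R" "\<And>w. g w \<in> carrier R"
  shows "conv R f g w \<in> carrier R"
  unfolding conv_def using assms by (auto intro!: finsum_closed)

lemma conv_Nil:
  assumes "\<And>w. f w \<in> carrier R" "\<And>w. g w \<in> carrier R"
  shows "conv R f g [] = f [] \<otimes> g []"
  unfolding conv_def using assms by simp

lemma conv_Cons:
  assumes "\<And>w. f w \<in> carrier R" "\<And>w. g w \<in> carrier R"
  shows "conv R f g (x # w) = f [] \<otimes> g (x # w) \<oplus> conv R (\<lambda>v. f (x # v)) g w"
proof -
  have "conv R f g (x # w) =
    (\<Oplus>i\<in>{..length w}. f (take (Suc i) (x # w)) \<otimes> g (drop (Suc i) (x # w)))
      \<oplus> f (take 0 (x # w)) \<otimes> g (drop 0 (x # w))"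
    unfolding conv_def using assms by (simp only: length_Cons, subst finsum_Suc2) auto
  then show ?thesis
    using assms conv_closed[of "\<lambda>v. f (x # v)" g w] by (simp add: conv_def a_comm)
qed

lemma conv_add_left:
  assumes "\<And>w. f w \<in> carrier R" "\<And>w. f' w \<in> carrier R" "\<And>w. g w \<in> carrier R"
  shows "conv R (\<lambda>w. f w \<oplus> f' w) g w = conv R f g w \<oplus> conv R f' g w"
  unfolding conv_def using assms by (subst finsum_addf[symmetric]) (auto simp: l_distr)

lemma conv_add_right:
  assumes "\<And>w. f w \<in> carrier R" "\<And>w. g w \<in> carrier R" "\<And>w. g' w \<in> carrier R"
  shows "conv R f (\<lambda>w. g w \<oplus> g' w) w = conv R f g w \<oplus> conv R f g' w"
  unfolding conv_def using assms by (subst finsum_addf[symmetric]) (auto simp: r_distr)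

lemma conv_smult_left:
  assumes "a \<in> carrier R" "\<And>w. f w \<in> carrier R" "\<And>w. g w \<in> carrier R"
  shows "conv R (\<lambda>w. a \<otimes> f w) g w = a \<otimes> conv R f g w"
  unfolding conv_def using assms by (subst finsum_rdistr) (auto simp: m_assoc)

lemma conv_assoc:
  assumes "\<And>w. f w \<in> carrier R" "\<And>w. g w \<in> carrier R" "\<And>w. h w \<in> carrier R"
  shows "conv R (conv R f g) h w = conv R f (conv R g h) w"
  using assms
proof (induction w arbitrary: f g)
  case Nil
  then show ?case by (simp add: conv_Nil conv_closed m_assoc)
next
  case (Cons x w)
  let ?f = "\<lambda>v. f (x # v)" and ?g = "\<lambda>v. g (x # v)"
  note c = Cons.prems conv_closed
  have "conv R (conv R f g) h (x # w) =
      (f [] \<otimes> g []) \<otimes> h (x # w) \<oplus> conv R (\<lambda>v. conv R f g (x # v)) h w"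
    using Cons.prems by (subst conv_Cons) (auto simp: conv_Nil intro: conv_closed)
  also have "(\<lambda>v. conv R f g (x # v)) = (\<lambda>v. f [] \<otimes> ?g v \<oplus> conv R ?f g v)"
    using c by (simp add: conv_Cons)
  also have "conv R \<dots> h w = f [] \<otimes> conv R ?g h w \<oplus> conv R (conv R ?f g) h w"
    using Cons.prems
    by (subst conv_add_left) (auto simp: conv_smult_left intro: conv_closed)
  also have "conv R (conv R ?f g) h w = conv R ?f (conv R g h) w"
    using c by (intro Cons.IH) auto
  finally have "conv R (conv R f g) h (x # w) = (f [] \<otimes> g []) \<otimes> h (x # w) \<oplus>
      (f [] \<otimes> conv R ?g h w \<oplus> conv R ?f (conv R g h) w)" .
  moreover have gh: "\<And>w. conv R g h w \<in> carrier R" "\<And>w. conv R ?g h w \<in> carrier R"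
      "\<And>w. conv R ?f (conv R g h) w \<in> carrier R"
    using Cons.prems by (auto intro!: conv_closed)
  then have "conv R f (conv R g h) (x # w) =
      f [] \<otimes> (g [] \<otimes> h (x # w) \<oplus> conv R ?g h w) \<oplus> conv R ?f (conv R g h) w"
    using Cons.prems by (simp add: conv_Cons)
  ultimately show ?case
    using Cons.prems gh by (simp add: r_distr m_assoc a_assoc)
qed

lemma conv_one_left:
  assumes "\<And>w. f w \<in> carrier R"
  shows "conv R (\<lambda>w. if w = [] then \<one> else \<zero>) f w = f w"
proof (cases w)
  case Nil
  then show ?thesis using assms by (simp add: conv_Nil)
next
  case (Cons x v)
  have "conv R (\<lambda>u. \<zero>) f v = \<zero>" unfolding conv_def using assms by simp
  then show ?thesis using assms Cons by (simp add: conv_Cons)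
qed

lemma conv_one_right:
  assumes "\<And>w. f w \<in> carrier R"
  shows "conv R f (\<lambda>w. if w = [] then \<one> else \<zero>) w = f w"
  using assms by (induction w arbitrary: f) (simp_all add: conv_Nil conv_Cons)

lemma conv_nonzeroE:
  assumes "\<And>w. f w \<in> carrier R" "\<And>w. g w \<in> carrier R" "conv R f g w \<noteq> \<zero>"
  obtains u v where "w = u @ v" "f u \<noteq> \<zero>" "g v \<noteq> \<zero>"
proof -
  have "\<exists>i\<in>{..length w}. f (take i w) \<otimes> g (drop i w) \<noteq> \<zero>"
  proof (rule ccontr)
    assume "\<not> ?thesis"
    then have "conv R f g w = (\<Oplus>i\<in>{..length w}. \<zero>)"
      unfolding conv_def by (intro finsum_cong') auto
    with assms(3) show False by simp
  qed
  then obtain i where "f (take i w) \<otimes> g (drop i w) \<noteq> \<zero>" by blast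
  then have "f (take i w) \<noteq> \<zero>" "g (drop i w) \<noteq> \<zero>"
    using assms(1,2) by auto
  then show thesis using that[of "take i w" "drop i w"] by simp
qed

lemma conv_in_free_algebra:
  assumes "f \<in> carrier (free_algebra R L)" "g \<in> carrier (free_algebra R L)"
  shows "conv R f g \<in> carrier (free_algebra R L)"
proof -
  have c: "\<And>w. f w \<in> carrier R" "\<And>w. g w \<in> carrier R"
    using assms by (auto simp: free_algebra_def)
  have "{w. conv R f g w \<noteq> \<zero>} \<subseteq> (\<lambda>(u, v). u @ v) ` ({u. f u \<noteq> \<zero>} \<times> {v. g v \<noteq> \<zero>})"
    by (auto elim!: conv_nonzeroE[OF c])
  then have "finite {w. conv R f g w \<noteq> \<zero>}"
    by (rule finite_subset) (use assms in \<open>auto simp: free_algebra_def\<close>)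
  moreover have "set w \<subseteq> L" if "conv R f g w \<noteq> \<zero>" for w
    using conv_nonzeroE[OF c that] assms unfolding free_algebra_def
    by (smt (verit, best) Un_least mem_Collect_eq partial_object.select_convs(1) set_append)
  ultimately show ?thesis
    using c by (auto simp: free_algebra_def conv_closed)
qed

lemma free_algebra_ring: "ring (free_algebra R L)"
proof (rule ringI)
  show "abelian_group (free_algebra R L)"
  proof (rule abelian_groupI)
    fix f g
    assume fg: "f \<in> carrier (free_algebra R L)" "g \<in> carrier (free_algebra R L)"
    have "{w. f w \<oplus> g w \<noteq> \<zero>} \<subseteq> {w. f w \<noteq> \<zero>} \<union> {w. g w \<noteq> \<zero>}" by auto
    then have "finite {w. f w \<oplus> g w \<noteq> \<zero>}"
      by (rule finite_subset) (use fg in \<open>auto simp: free_algebra_def\<close>)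
    moreover have "set w \<subseteq> L" if "f w \<oplus> g w \<noteq> \<zero>" for w
      using fg that by (cases "f w = \<zero>") (auto simp: free_algebra_def)
    ultimately show "f \<oplus>\<^bsub>free_algebra R L\<^esub> g \<in> carrier (free_algebra R L)"
      using fg by (auto simp: free_algebra_def)
  next
    fix f assume f: "f \<in> carrier (free_algebra R L)"
    then have "\<And>w. \<ominus> f w \<noteq> \<zero> \<longleftrightarrow> f w \<noteq> \<zero>"
      by (simp add: free_algebra_def)
    with f show "\<exists>g\<in>carrier (free_algebra R L). g \<oplus>\<^bsub>free_algebra R L\<^esub> f = \<zero>\<^bsub>free_algebra R L\<^esub>"
      by (intro bexI[of _ "\<lambda>w. \<ominus> f w"]) (auto simp: free_algebra_def l_neg)
  qed (auto simp: free_algebra_def a_ac fun_eq_iff)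
  show "monoid (free_algebra R L)"
  proof (rule monoidI)
    fix f g assume "f \<in> carrier (free_algebra R L)" "g \<in> carrier (free_algebra R L)"
    from conv_in_free_algebra[OF this]
    show "f \<otimes>\<^bsub>free_algebra R L\<^esub> g \<in> carrier (free_algebra R L)"
      by (simp add: free_algebra_def)
  qed (auto simp: free_algebra_def conv_assoc conv_one_left conv_one_right fun_eq_iff)
qed (auto simp: free_algebra_def conv_add_left conv_add_right fun_eq_iff)

end


section \<open>The Weyl algebra\<close>

datatype weyl_letter = LX nat | LD nat

definition weyl_letters :: "nat \<Rightarrow> weyl_letter set"
  where "weyl_letters m = LX ` {1..m} \<union> LD ` {1..m}"

definition weyl_free :: "('a, 'x) ring_scheme \<Rightarrow> nat \<Rightarrow> (weyl_letter list \<Rightarrow> 'a) ring"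
  where "weyl_free A m = free_algebra A (weyl_letters m)"

definition weyl_relations :: "('a, 'x) ring_scheme \<Rightarrow> nat \<Rightarrow> (weyl_letter list \<Rightarrow> 'a) set"
  where "weyl_relations A m =
    (let F = weyl_free A m; x = (\<lambda>i. letter A (LX i)); d = (\<lambda>i. letter A (LD i)) in
      {x i \<otimes>\<^bsub>F\<^esub> x j \<ominus>\<^bsub>F\<^esub> x j \<otimes>\<^bsub>F\<^esub> x i | i j. i \<in> {1..m} \<and> j \<in> {1..m}} \<union>
      {d i \<otimes>\<^bsub>F\<^esub> d j \<ominus>\<^bsub>F\<^esub> d j \<otimes>\<^bsub>F\<^esub> d i | i j. i \<in> {1..m} \<and> j \<in> {1..m}} \<union>
      {(d i \<otimes>\<^bsub>F\<^esub> x j \<ominus>\<^bsub>F\<^esub> x j \<otimes>\<^bsub>F\<^esub> d i) \<ominus>\<^bsub>F\<^esub> (if i = j then \<one>\<^bsub>F\<^esub> else \<zero>\<^bsub>F\<^esub>)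
        | i j. i \<in> {1..m} \<and> j \<in> {1..m}})"

definition weyl_ideal :: "('a, 'x) ring_scheme \<Rightarrow> nat \<Rightarrow> (weyl_letter list \<Rightarrow> 'a) set"
  where "weyl_ideal A m = Idl\<^bsub>weyl_free A m\<^esub> (weyl_relations A m)"

definition weyl_algebra :: "('a, 'x) ring_scheme \<Rightarrow> nat \<Rightarrow> (weyl_letter list \<Rightarrow> 'a) set ring"
  where "weyl_algebra A m = weyl_free A m Quot weyl_ideal A m"

definition weyl_class ::
    "('a, 'x) ring_scheme \<Rightarrow> nat \<Rightarrow> (weyl_letter list \<Rightarrow> 'a) \<Rightarrow> (weyl_letter list \<Rightarrow> 'a) set"
  where "weyl_class A m f = weyl_ideal A m +>\<^bsub>weyl_free A m\<^esub> f"

definition weyl_X :: "('a, 'x) ring_scheme \<Rightarrow> nat \<Rightarrow> nat \<Rightarrow> (weyl_letter list \<Rightarrow> 'a) set"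
  where "weyl_X A m i = weyl_class A m (letter A (LX i))"

definition weyl_D :: "('a, 'x) ring_scheme \<Rightarrow> nat \<Rightarrow> nat \<Rightarrow> (weyl_letter list \<Rightarrow> 'a) set"
  where "weyl_D A m i = weyl_class A m (letter A (LD i))"

fun letter_degree :: "weyl_letter \<Rightarrow> int" where
  "letter_degree (LX i) = 1"
| "letter_degree (LD i) = - 1"

definition word_degree :: "weyl_letter list \<Rightarrow> int"
  where "word_degree w = sum_list (map letter_degree w)"

definition weyl_component :: "('a, 'x) ring_scheme \<Rightarrow> nat \<Rightarrow> int \<Rightarrow> (weyl_letter list \<Rightarrow> 'a) set set"
  where "weyl_component A m k =
    {weyl_class A m f | f. f \<in> carrier (weyl_free A m) \<and> (\<forall>w. f w \<noteq> \<zero>\<^bsub>A\<^esub> \<longrightarrow> word_degree w = k)}"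

definition weyl_euler :: "('a, 'x) ring_scheme \<Rightarrow> nat \<Rightarrow> (weyl_letter list \<Rightarrow> 'a) set"
  where "weyl_euler A m = 
    (\<Oplus>\<^bsub>weyl_algebra A m\<^esub>i\<in>{1..m}. weyl_X A m i \<otimes>\<^bsub>weyl_algebra A m\<^esub> weyl_D A m i)"

lemma letter_in_free_algebra:
  assumes "ring A" "a \<in> L"
  shows "letter A a \<in> carrier (free_algebra A L)"
proof -
  interpret ring A by fact
  show ?thesis using assms(2) by (auto simp: letter_def free_algebra_def)
qed

lemma weyl_relations_subset:
  assumes "ring A"
  shows "weyl_relations A m \<subseteq> carrier (weyl_free A m)"
proof -
  interpret F: ring "weyl_free A m"
    unfolding weyl_free_def by (rule ring.free_algebra_ring[OF assms])
  have "letter A (LX i) \<in> carrier (weyl_free A m)" "letter A (LD i) \<in> carrier (weyl_free A m)"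
    if "i \<in> {1..m}" for i
    using that by (auto simp: weyl_free_def weyl_letters_def intro!: letter_in_free_algebra assms)
  then show ?thesis by (auto simp: weyl_relations_def Let_def)
qed

lemma weyl_ideal_ideal:
  assumes "ring A"
  shows "ideal (weyl_ideal A m) (weyl_free A m)"
  unfolding weyl_ideal_def
  by (rule ring.genideal_ideal) (simp_all add: weyl_free_def ring.free_algebra_ring[OF assms]
    weyl_relations_subset[OF assms, unfolded weyl_free_def])

lemma weyl_algebra_ring:
  assumes "ring A"
  shows "ring (weyl_algebra A m)"
  unfolding weyl_algebra_def by (rule ideal.quotient_is_ring[OF weyl_ideal_ideal[OF assms]])


section \<open>Graded modules\<close>

text \<open>The library's locale for modules requires a commutative ring of scalars; its axioms are
  restated here for left modules over an arbitrary ring.\<close>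

locale left_module = R?: ring R + M?: abelian_group M
  for R :: "('r, 'x) ring_scheme" (structure) and M :: "('r, 'b, 'y) module_scheme" (structure) +
  assumes smult_closed:
      "\<lbrakk>a \<in> carrier R; x \<in> carrier M\<rbrakk> \<Longrightarrow> a \<odot>\<^bsub>M\<^esub> x \<in> carrier M"
    and smult_l_distr:
      "\<lbrakk>a \<in> carrier R; b \<in> carrier R; x \<in> carrier M\<rbrakk> \<Longrightarrow>
        (a \<oplus> b) \<odot>\<^bsub>M\<^esub> x = a \<odot>\<^bsub>M\<^esub> x \<oplus>\<^bsub>M\<^esub> b \<odot>\<^bsub>M\<^esub> x"
    and smult_r_distr:
      "\<lbrakk>a \<in> carrier R; x \<in> carrier M; y \<in> carrier M\<rbrakk> \<Longrightarrow>
        a \<odot>\<^bsub>M\<^esub> (x \<oplus>\<^bsub>M\<^esub> y) = a \<odot>\<^bsub>M\<^esub> x \<oplus>\<^bsub>M\<^esub> a \<odot>\<^bsub>M\<^esub> y"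
    and smult_assoc:
      "\<lbrakk>a \<in> carrier R; b \<in> carrier R; x \<in> carrier M\<rbrakk> \<Longrightarrow>
        (a \<otimes> b) \<odot>\<^bsub>M\<^esub> x = a \<odot>\<^bsub>M\<^esub> (b \<odot>\<^bsub>M\<^esub> x)"
    and smult_one:
      "x \<in> carrier M \<Longrightarrow> \<one> \<odot>\<^bsub>M\<^esub> x = x"

definition internal_direct_sum :: "('b, 'y) ring_scheme \<Rightarrow> (int \<Rightarrow> 'b set) \<Rightarrow> bool"
  where "internal_direct_sum M C \<longleftrightarrow>
    (\<forall>n. additive_subgroup (C n) M) \<and>
    (\<forall>x\<in>carrier M. \<exists>!f. (\<forall>n. f n \<in> C n) \<and> finite {n. f n \<noteq> \<zero>\<^bsub>M\<^esub>} \<and>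
       x = (\<Oplus>\<^bsub>M\<^esub>n\<in>{n. f n \<noteq> \<zero>\<^bsub>M\<^esub>}. f n))"

locale graded_weyl_module =
  left_module "weyl_algebra A m" M
  for A :: "('a, 'x) ring_scheme" and m :: nat
    and M :: "((weyl_letter list \<Rightarrow> 'a) set, 'b, 'y) module_scheme" +
  fixes C :: "int \<Rightarrow> 'b set"
  assumes direct_sum: "internal_direct_sum M C"
    and component_smult:
      "\<lbrakk>u \<in> weyl_component A m k; y \<in> C n\<rbrakk> \<Longrightarrow> u \<odot>\<^bsub>M\<^esub> y \<in> C (k + n)"

locale generalized_eulerian = graded_weyl_module +
  assumes eulerian:
    "y \<in> C n \<Longrightarrow> \<exists>a::nat. a > 0 \<and>
      ((weyl_euler A m \<ominus>\<^bsub>weyl_algebra A m\<^esub> add_pow (weyl_algebra A m) n \<one>\<^bsub>weyl_algebra A m\<^esub>)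
         [^]\<^bsub>weyl_algebra A m\<^esub> a) \<odot>\<^bsub>M\<^esub> y = \<zero>\<^bsub>M\<^esub>"

end

theory Submission
  imports Defs
begin

text \<open>The Euler operator \<open>E = \<Sum> X\<^sub>i \<partial>\<^sub>i\<close> acts on \<open>C n\<close> with the single generalized eigenvalue \<open>n\<close>,
  and this forces neighbouring components to vanish together, except in two places. Let
  \<open>y \<in> C n\<close>.

  If \<open>C (n - 1) = 0\<close>, then every \<open>\<partial>\<^sub>i y\<close> vanishes, so \<open>E y = 0\<close>. Hence \<open>E - n\<close> multiplies \<open>y\<close> by
  \<open>- n\<close>, and the nilpotency of \<open>E - n\<close> on \<open>y\<close> gives \<open>(- n)\<^sup>a y = 0\<close>. In characteristic zero this
  means \<open>y = 0\<close> unless \<open>n = 0\<close>.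

  If \<open>C (n + 1) = 0\<close>, then every \<open>X\<^sub>i y\<close> vanishes. Since \<open>\<partial>\<^sub>i X\<^sub>i = X\<^sub>i \<partial>\<^sub>i + 1\<close>, this gives
  \<open>E y = - m y\<close>, and in the same way \<open>y = 0\<close> unless \<open>n = - m\<close>.

  So a nonzero component at \<open>n\<close> propagates to \<open>n - 1\<close> if \<open>n \<noteq> 0\<close> and to \<open>n + 1\<close> if \<open>n \<noteq> - m\<close>
  (\<open>component_below_nontrivial\<close> and \<open>component_above_nontrivial\<close>). The two exceptional degrees
  divide \<open>\<int>\<close> into blocks inside which nonvanishing spreads to every degree. As \<open>m \<ge> 1\<close>, the
  half-lines \<open>n \<ge> 0\<close> and \<open>n \<le> - m\<close> are two of these blocks. The equivalences say exactly this.\<close>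

section \<open>Scalars acting on left modules\<close>

context left_module
begin

lemma smult_hom_scalars:
  assumes "y \<in> carrier M"
  shows "group_hom (add_monoid R) (add_monoid M) (\<lambda>r. r \<odot>\<^bsub>M\<^esub> y)"
  by (intro group_hom.intro group_hom_axioms.intro R.a_group M.a_group homI)
    (auto simp: assms smult_closed smult_l_distr)

lemma smult_hom_vectors:
  assumes "r \<in> carrier R"
  shows "group_hom (add_monoid M) (add_monoid M) (\<lambda>y. r \<odot>\<^bsub>M\<^esub> y)"
  by (intro group_hom.intro group_hom_axioms.intro M.a_group homI)
    (auto simp: assms smult_closed smult_r_distr)

lemma smult_zero_left: "y \<in> carrier M \<Longrightarrow> \<zero> \<odot>\<^bsub>M\<^esub> y = \<zero>\<^bsub>M\<^esub>"
  using group_hom.hom_one[OF smult_hom_scalars] by simp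

lemma smult_zero_right: "r \<in> carrier R \<Longrightarrow> r \<odot>\<^bsub>M\<^esub> \<zero>\<^bsub>M\<^esub> = \<zero>\<^bsub>M\<^esub>"
  using group_hom.hom_one[OF smult_hom_vectors] by simp

lemma smult_add_pow_right:
  fixes k :: int
  assumes "r \<in> carrier R" "y \<in> carrier M"
  shows "r \<odot>\<^bsub>M\<^esub> ([k] \<cdot>\<^bsub>M\<^esub> y) = [k] \<cdot>\<^bsub>M\<^esub> (r \<odot>\<^bsub>M\<^esub> y)"
  using group_hom.hom_int_pow[OF smult_hom_vectors[OF assms(1)], of y k] assms(2)
  by (simp add: add_pow_def)

lemma add_pow_one_smult:
  fixes k :: int
  assumes "y \<in> carrier M"
  shows "([k] \<cdot> \<one>) \<odot>\<^bsub>M\<^esub> y = [k] \<cdot>\<^bsub>M\<^esub> y"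
  using group_hom.hom_int_pow[OF smult_hom_scalars[OF assms], of \<one> k]
  by (simp add: add_pow_def smult_one assms)

lemma smult_minus_left:
  assumes "r \<in> carrier R" "y \<in> carrier M"
  shows "(\<ominus> r) \<odot>\<^bsub>M\<^esub> y = \<ominus>\<^bsub>M\<^esub> (r \<odot>\<^bsub>M\<^esub> y)"
  using group_hom.hom_inv[OF smult_hom_scalars[OF assms(2)], of r] assms(1)
  by (simp add: a_inv_def)

lemma finsum_smult:
  assumes "finite I" "\<And>i. i \<in> I \<Longrightarrow> r i \<in> carrier R" "y \<in> carrier M"
  shows "(\<Oplus>i\<in>I. r i) \<odot>\<^bsub>M\<^esub> y = (\<Oplus>\<^bsub>M\<^esub>i\<in>I. r i \<odot>\<^bsub>M\<^esub> y)"
  using assms(1,2)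
proof (induction I)
  case (insert i I)
  then have "r \<in> I \<rightarrow> carrier R" "r i \<in> carrier R"
    "(\<lambda>i. r i \<odot>\<^bsub>M\<^esub> y) \<in> I \<rightarrow> carrier M" "r i \<odot>\<^bsub>M\<^esub> y \<in> carrier M"
    by (auto simp: smult_closed assms(3))
  with insert show ?case
    by (simp add: smult_l_distr assms(3))
qed (simp add: smult_zero_left assms(3))

text \<open>An eigenvector whose integer eigenvalue is not a zero divisor on the module cannot be
  killed by a power of the operator: \<open>z\<^sup>a y = j\<^sup>a y\<close>.\<close>

lemma eigenvector_killed_by_power_zero:
  fixes j :: int and a :: nat
  assumes "z \<in> carrier R" "y \<in> carrier M"
    and eig: "z \<odot>\<^bsub>M\<^esub> y = [j] \<cdot>\<^bsub>M\<^esub> y"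
    and torsion_free: "\<And>v. v \<in> carrier M \<Longrightarrow> [j] \<cdot>\<^bsub>M\<^esub> v = \<zero>\<^bsub>M\<^esub> \<Longrightarrow> v = \<zero>\<^bsub>M\<^esub>"
    and "(z [^] a) \<odot>\<^bsub>M\<^esub> y = \<zero>\<^bsub>M\<^esub>"
  shows "y = \<zero>\<^bsub>M\<^esub>"
  using assms(5)
proof (induction a)
  case (Suc a)
  have "[j] \<cdot>\<^bsub>M\<^esub> ((z [^] a) \<odot>\<^bsub>M\<^esub> y) = (z [^] a) \<odot>\<^bsub>M\<^esub> (z \<odot>\<^bsub>M\<^esub> y)"
    by (simp add: assms(1,2) eig smult_add_pow_right)
  also have "\<dots> = \<zero>\<^bsub>M\<^esub>"
    using Suc.prems by (simp add: assms(1,2) smult_assoc)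
  finally show ?case
    by (rule Suc.IH[OF torsion_free[rotated]]) (simp_all add: assms(1,2) smult_closed)
qed (simp add: smult_one assms(2))

lemma torsion_free_if_invertible:
  fixes n :: nat
  assumes "c \<in> carrier R" "c \<otimes> ([n] \<cdot> \<one>) = \<one>"
    and "v \<in> carrier M" "[n] \<cdot>\<^bsub>M\<^esub> v = \<zero>\<^bsub>M\<^esub>"
  shows "v = \<zero>\<^bsub>M\<^esub>"
proof -
  have "([n] \<cdot> \<one>) \<odot>\<^bsub>M\<^esub> v = \<zero>\<^bsub>M\<^esub>"
    using add_pow_one_smult[OF assms(3), of "int n"] assms(4) by (simp add: add_pow_def int_pow_int)
  then have "(c \<otimes> ([n] \<cdot> \<one>)) \<odot>\<^bsub>M\<^esub> v = \<zero>\<^bsub>M\<^esub>"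
    by (simp add: assms(1,3) smult_assoc smult_zero_right)
  then show ?thesis
    by (simp add: assms(2,3) smult_one)
qed

end


section \<open>Constants and generators in the Weyl algebra\<close>

definition free_const :: "('a, 'x) ring_scheme \<Rightarrow> 'a \<Rightarrow> 'l list \<Rightarrow> 'a"
  where "free_const A c = (\<lambda>w. if w = [] then c else \<zero>\<^bsub>A\<^esub>)"

lemma (in ring) free_const_ring_hom: "free_const R \<in> ring_hom R (free_algebra R L)"
proof (rule ring_hom_memI)
  fix c d assume cd: "c \<in> carrier R" "d \<in> carrier R"
  have c: "free_const R c = (\<lambda>w. c \<otimes> (if w = [] then \<one> else \<zero>))"
    using cd by (simp add: free_const_def fun_eq_iff)
  have d: "free_const R d w \<in> carrier R" for w :: "'c list"
    using cd by (simp add: free_const_def)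
  have "conv R (free_const R c) (free_const R d) w = c \<otimes> free_const R d w" for w :: "'c list"
    unfolding c by (subst conv_smult_left) (simp_all add: cd d conv_one_left)
  then have "conv R (free_const R c) (free_const R d) w = free_const R (c \<otimes> d) w" for w :: "'c list"
    using cd by (simp add: free_const_def)
  then show "free_const R (c \<otimes> d) = free_const R c \<otimes>\<^bsub>free_algebra R L\<^esub> free_const R d"
    by (simp add: free_algebra_def fun_eq_iff)
  show "free_const R (c \<oplus> d) = free_const R c \<oplus>\<^bsub>free_algebra R L\<^esub> free_const R d"
    using cd by (simp add: free_algebra_def free_const_def fun_eq_iff)
next
  fix c assume c: "c \<in> carrier R"
  have "finite {w. free_const R c w \<noteq> \<zero>}"
    by (rule finite_subset[of _ "{[]}"]) (auto simp: free_const_def)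
  then show "free_const R c \<in> carrier (free_algebra R L)"
    using c by (simp add: free_algebra_def free_const_def)
qed (simp add: free_algebra_def free_const_def)

context
  fixes A :: "('a, 'x) ring_scheme" and m :: nat
  assumes ring_A: "ring A"
begin

interpretation A: ring A by (rule ring_A)
interpretation F: ring "weyl_free A m"
  unfolding weyl_free_def by (rule A.free_algebra_ring)
interpretation I: ideal "weyl_ideal A m" "weyl_free A m"
  by (rule weyl_ideal_ideal[OF ring_A])
interpretation W: ring "weyl_algebra A m"
  by (rule weyl_algebra_ring[OF ring_A])

lemma weyl_class_ring_hom: "weyl_class A m \<in> ring_hom (weyl_free A m) (weyl_algebra A m)"
  using I.rcos_ring_hom by (simp add: weyl_class_def[abs_def] weyl_algebra_def)

interpretation H: ring_hom_ring "weyl_free A m" "weyl_algebra A m" "weyl_class A m"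
  by (rule ring_hom_ringI2[OF F.ring_axioms W.ring_axioms weyl_class_ring_hom])

lemma weyl_const_ring_hom:
  "(\<lambda>c. weyl_class A m (free_const A c)) \<in> ring_hom A (weyl_algebra A m)"
  using ring_hom_trans[OF A.free_const_ring_hom weyl_class_ring_hom[unfolded weyl_free_def]]
  by (simp add: comp_def)

lemma letter_closed:
  assumes "i \<in> {1..m}"
  shows "letter A (LX i) \<in> carrier (weyl_free A m)" "letter A (LD i) \<in> carrier (weyl_free A m)"
  using assms by (auto simp: weyl_free_def weyl_letters_def intro!: letter_in_free_algebra ring_A)

lemma weyl_X_closed: "i \<in> {1..m} \<Longrightarrow> weyl_X A m i \<in> carrier (weyl_algebra A m)"
  unfolding weyl_X_def by (intro H.hom_closed letter_closed)

lemma weyl_D_closed: "i \<in> {1..m} \<Longrightarrow> weyl_D A m i \<in> carrier (weyl_algebra A m)"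
  unfolding weyl_D_def by (intro H.hom_closed letter_closed)

lemma weyl_X_component: "i \<in> {1..m} \<Longrightarrow> weyl_X A m i \<in> weyl_component A m 1"
  unfolding weyl_X_def weyl_component_def
  by (intro CollectI exI[of _ "letter A (LX i)"])
    (auto simp: letter_closed, auto simp: letter_def word_degree_def split: if_splits)

lemma weyl_D_component: "i \<in> {1..m} \<Longrightarrow> weyl_D A m i \<in> weyl_component A m (- 1)"
  unfolding weyl_D_def weyl_component_def
  by (intro CollectI exI[of _ "letter A (LD i)"])
    (auto simp: letter_closed, auto simp: letter_def word_degree_def split: if_splits)

lemma weyl_D_X_commute:
  assumes i: "i \<in> {1..m}"
  shows "weyl_D A m i \<otimes>\<^bsub>weyl_algebra A m\<^esub> weyl_X A m i =
    weyl_X A m i \<otimes>\<^bsub>weyl_algebra A m\<^esub> weyl_D A m i \<oplus>\<^bsub>weyl_algebra A m\<^esub> \<one>\<^bsub>weyl_algebra A m\<^esub>"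
proof -
  let ?F = "weyl_free A m" and ?W = "weyl_algebra A m"
  let ?x = "letter A (LX i)" and ?d = "letter A (LD i)"
  let ?r = "(?d \<otimes>\<^bsub>?F\<^esub> ?x \<ominus>\<^bsub>?F\<^esub> ?x \<otimes>\<^bsub>?F\<^esub> ?d) \<ominus>\<^bsub>?F\<^esub> \<one>\<^bsub>?F\<^esub>"
  note c = letter_closed[OF i] weyl_X_closed[OF i] weyl_D_closed[OF i]
  have "?r \<in> weyl_relations A m"
    unfolding weyl_relations_def Let_def using i
    by (intro UnI2 CollectI exI[of _ i] conjI) (simp_all only: if_True refl)
  then have "?r \<in> weyl_ideal A m"
    using F.genideal_self[OF weyl_relations_subset[OF ring_A]] by (auto simp: weyl_ideal_def)
  then have "weyl_class A m ?r = \<zero>\<^bsub>?W\<^esub>"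
    using F.a_rcos_zero[OF I.ideal_axioms] by (simp add: weyl_class_def weyl_algebra_def FactRing_def)
  then have "(weyl_D A m i \<otimes>\<^bsub>?W\<^esub> weyl_X A m i \<ominus>\<^bsub>?W\<^esub> weyl_X A m i \<otimes>\<^bsub>?W\<^esub> weyl_D A m i) \<ominus>\<^bsub>?W\<^esub> \<one>\<^bsub>?W\<^esub> = \<zero>\<^bsub>?W\<^esub>"
    using c(1,2) by (simp add: weyl_X_def weyl_D_def a_minus_def)
  then have "weyl_D A m i \<otimes>\<^bsub>?W\<^esub> weyl_X A m i \<ominus>\<^bsub>?W\<^esub> weyl_X A m i \<otimes>\<^bsub>?W\<^esub> weyl_D A m i = \<one>\<^bsub>?W\<^esub>"
    using c by (subst (asm) W.r_right_minus_eq) auto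
  then have "weyl_X A m i \<otimes>\<^bsub>?W\<^esub> weyl_D A m i \<oplus>\<^bsub>?W\<^esub> \<one>\<^bsub>?W\<^esub> =
    weyl_X A m i \<otimes>\<^bsub>?W\<^esub> weyl_D A m i \<oplus>\<^bsub>?W\<^esub>
      (weyl_D A m i \<otimes>\<^bsub>?W\<^esub> weyl_X A m i \<ominus>\<^bsub>?W\<^esub> weyl_X A m i \<otimes>\<^bsub>?W\<^esub> weyl_D A m i)"
    by simp
  then show ?thesis
    using c(3,4) by (simp add: a_minus_def W.a_ac W.r_neg)
qed

lemma weyl_euler_closed: "weyl_euler A m \<in> carrier (weyl_algebra A m)"
  unfolding weyl_euler_def by (auto intro!: W.finsum_closed simp: weyl_X_closed weyl_D_closed)

text \<open>A positive integer is a nonzero element of the field of constants, so it is inverted by a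
  constant of the Weyl algebra.\<close>

lemma weyl_nat_invertible:
  fixes n :: nat
  assumes "subfield K A" and "[n] \<cdot>\<^bsub>A\<^esub> \<one>\<^bsub>A\<^esub> \<noteq> \<zero>\<^bsub>A\<^esub>"
  obtains c where "c \<in> carrier (weyl_algebra A m)"
    "c \<otimes>\<^bsub>weyl_algebra A m\<^esub> ([n] \<cdot>\<^bsub>weyl_algebra A m\<^esub> \<one>\<^bsub>weyl_algebra A m\<^esub>) = \<one>\<^bsub>weyl_algebra A m\<^esub>"
proof -
  let ?h = "\<lambda>c. weyl_class A m (free_const A c)"
  interpret h: ring_hom_ring A "weyl_algebra A m" ?h
    by (rule ring_hom_ringI2[OF ring_A W.ring_axioms weyl_const_ring_hom])
  interpret K: subring K A by (rule subfieldE(1)[OF assms(1)])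
  have "[n] \<cdot>\<^bsub>A\<^esub> \<one>\<^bsub>A\<^esub> \<in> K" for n :: nat
    by (induction n) (auto simp: add_pow_def intro: subringE[OF subfieldE(1)[OF assms(1)]])
  with assms(2) have nK: "[n] \<cdot>\<^bsub>A\<^esub> \<one>\<^bsub>A\<^esub> \<in> K - {\<zero>\<^bsub>A\<^esub>}" by simp
  let ?c = "inv\<^bsub>A\<^esub> ([n] \<cdot>\<^bsub>A\<^esub> \<one>\<^bsub>A\<^esub>)"
  note c = A.subfield_m_inv[OF assms(1) nK]
  have cA: "?c \<in> carrier A" using c(1) subfieldE(3)[OF assms(1)] by blast
  have "?h ([n] \<cdot>\<^bsub>A\<^esub> \<one>\<^bsub>A\<^esub>) = [n] \<cdot>\<^bsub>weyl_algebra A m\<^esub> \<one>\<^bsub>weyl_algebra A m\<^esub>"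
    using group_hom.hom_nat_pow[OF h.a_group_hom, of "\<one>\<^bsub>A\<^esub>" n] by (simp add: add_pow_def)
  moreover have "?h ?c \<otimes>\<^bsub>weyl_algebra A m\<^esub> ?h ([n] \<cdot>\<^bsub>A\<^esub> \<one>\<^bsub>A\<^esub>) = \<one>\<^bsub>weyl_algebra A m\<^esub>"
    using cA c(3) h.hom_mult[of ?c "[n] \<cdot>\<^bsub>A\<^esub> \<one>\<^bsub>A\<^esub>"] h.hom_one by simp
  ultimately show thesis using that[of "?h ?c"] cA by simp
qed

end


section \<open>Propagation of nonzero components\<close>

context generalized_eulerian
begin

lemma component_subset: "C n \<subseteq> carrier M"
  using direct_sum by (auto simp: internal_direct_sum_def dest: additive_subgroup.a_subset)

lemma component_zero: "\<zero>\<^bsub>M\<^esub> \<in> C n"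
  using direct_sum additive_subgroup.zero_closed[of "C n" M] by (auto simp: internal_direct_sum_def)

context
  fixes K :: "'a set"
  assumes ring_A: "ring A"
    and subfield: "subfield K A"
    and char_zero: "\<And>n::nat. n > 0 \<Longrightarrow> [n] \<cdot>\<^bsub>A\<^esub> \<one>\<^bsub>A\<^esub> \<noteq> \<zero>\<^bsub>A\<^esub>"
begin

lemma int_torsion_free:
  fixes j :: int
  assumes "j \<noteq> 0" "v \<in> carrier M" "[j] \<cdot>\<^bsub>M\<^esub> v = \<zero>\<^bsub>M\<^esub>"
  shows "v = \<zero>\<^bsub>M\<^esub>"
proof -
  let ?n = "nat \<bar>j\<bar>"
  have "[?n] \<cdot>\<^bsub>M\<^esub> v = \<zero>\<^bsub>M\<^esub>"
  proof (cases "j \<ge> 0")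
    case True
    then show ?thesis using assms(3) by (simp add: add_pow_int_ge)
  next
    case False
    then have "\<ominus>\<^bsub>M\<^esub> ([?n] \<cdot>\<^bsub>M\<^esub> v) = \<zero>\<^bsub>M\<^esub>" using assms(3) by (simp add: add_pow_int_lt)
    then show ?thesis
      using assms(2) M.minus_minus[of "[?n] \<cdot>\<^bsub>M\<^esub> v"] by simp
  qed
  moreover obtain c where "c \<in> carrier (weyl_algebra A m)"
    "c \<otimes>\<^bsub>weyl_algebra A m\<^esub> ([?n] \<cdot>\<^bsub>weyl_algebra A m\<^esub> \<one>\<^bsub>weyl_algebra A m\<^esub>) = \<one>\<^bsub>weyl_algebra A m\<^esub>"
    using weyl_nat_invertible[OF ring_A subfield char_zero[of ?n]] assms(1) by auto
  ultimately show ?thesis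
    using torsion_free_if_invertible assms(2) by blast
qed

lemma euler_smult:
  assumes "y \<in> carrier M"
  shows "weyl_euler A m \<odot>\<^bsub>M\<^esub> y =
    (\<Oplus>\<^bsub>M\<^esub>i\<in>{1..m}. weyl_X A m i \<odot>\<^bsub>M\<^esub> (weyl_D A m i \<odot>\<^bsub>M\<^esub> y))"
  unfolding weyl_euler_def using assms
  by (subst finsum_smult)
    (auto simp: weyl_X_closed[OF ring_A] weyl_D_closed[OF ring_A] smult_assoc smult_closed
      intro!: M.finsum_cong')

text \<open>\<open>E - n\<close> is nilpotent on \<open>y\<close> but multiplies it by the integer \<open>k - n\<close>, which acts
  injectively when it is nonzero.\<close>

lemma euler_eigenvalue_unique:
  fixes k n :: int
  assumes y: "y \<in> C n" and eig: "weyl_euler A m \<odot>\<^bsub>M\<^esub> y = [k] \<cdot>\<^bsub>M\<^esub> y" and "k \<noteq> n"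
  shows "y = \<zero>\<^bsub>M\<^esub>"
proof -
  let ?W = "weyl_algebra A m"
  let ?z = "weyl_euler A m \<ominus>\<^bsub>?W\<^esub> [n] \<cdot>\<^bsub>?W\<^esub> \<one>\<^bsub>?W\<^esub>"
  note E = weyl_euler_closed[OF ring_A, of m]
  have yM: "y \<in> carrier M" using y component_subset by blast
  have "?z \<odot>\<^bsub>M\<^esub> y = [k] \<cdot>\<^bsub>M\<^esub> y \<oplus>\<^bsub>M\<^esub> (\<ominus>\<^bsub>M\<^esub> ([n] \<cdot>\<^bsub>M\<^esub> y))"
    using E yM by (simp add: a_minus_def smult_l_distr smult_minus_left eig add_pow_one_smult)
  also have "\<dots> = [(k - n)] \<cdot>\<^bsub>M\<^esub> y"
    using M.add.int_pow_diff[OF yM, of k n] by (simp add: a_inv_def add_pow_def)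
  finally have z: "?z \<odot>\<^bsub>M\<^esub> y = [(k - n)] \<cdot>\<^bsub>M\<^esub> y" .
  have zW: "?z \<in> carrier ?W" using E by simp
  from eulerian[OF y] obtain a :: nat where a: "(?z [^]\<^bsub>?W\<^esub> a) \<odot>\<^bsub>M\<^esub> y = \<zero>\<^bsub>M\<^esub>"
    by blast
  have j: "k - n \<noteq> 0" using \<open>k \<noteq> n\<close> by simp
  show ?thesis
    by (rule eigenvector_killed_by_power_zero[OF zW yM z int_torsion_free[OF j] a])
qed

text \<open>If the component below is zero, all \<open>\<partial>\<^sub>i\<close> annihilate \<open>C n\<close>, so the Euler operator has
  eigenvalue \<open>0\<close> there.\<close>

lemma component_below_nontrivial:
  assumes "C n \<noteq> {\<zero>\<^bsub>M\<^esub>}" and "n \<noteq> 0"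
  shows "C (n - 1) \<noteq> {\<zero>\<^bsub>M\<^esub>}"
proof
  assume trivial: "C (n - 1) = {\<zero>\<^bsub>M\<^esub>}"
  have "y = \<zero>\<^bsub>M\<^esub>" if y: "y \<in> C n" for y
  proof (rule euler_eigenvalue_unique[OF y, of 0])
    have yM: "y \<in> carrier M" using y component_subset by blast
    have "weyl_D A m i \<odot>\<^bsub>M\<^esub> y = \<zero>\<^bsub>M\<^esub>" if "i \<in> {1..m}" for i
      using component_smult[OF weyl_D_component[OF ring_A that] y] trivial by simp
    then have "weyl_euler A m \<odot>\<^bsub>M\<^esub> y = (\<Oplus>\<^bsub>M\<^esub>i\<in>{1..m}. \<zero>\<^bsub>M\<^esub>)"
      unfolding euler_smult[OF yM]
      by (intro M.finsum_cong') (auto simp: weyl_X_closed[OF ring_A] smult_zero_right)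
    then show "weyl_euler A m \<odot>\<^bsub>M\<^esub> y = [(0::int)] \<cdot>\<^bsub>M\<^esub> y"
      by (simp add: add_pow_def)
  qed (use assms(2) in simp)
  with assms(1) component_zero show False by blast
qed

text \<open>If the component above is zero, all \<open>X\<^sub>i\<close> annihilate \<open>C n\<close>, and moving them to the right of
  the \<open>\<partial>\<^sub>i\<close> costs \<open>1\<close> for each of the \<open>m\<close> variables: the eigenvalue is \<open>- m\<close>.\<close>

lemma component_above_nontrivial:
  assumes "C n \<noteq> {\<zero>\<^bsub>M\<^esub>}" and "n \<noteq> - int m"
  shows "C (n + 1) \<noteq> {\<zero>\<^bsub>M\<^esub>}"
proof
  assume trivial: "C (n + 1) = {\<zero>\<^bsub>M\<^esub>}"
  have "y = \<zero>\<^bsub>M\<^esub>" if y: "y \<in> C n" for y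
  proof (rule euler_eigenvalue_unique[OF y, of "- int m"])
    have yM: "y \<in> carrier M" using y component_subset by blast
    have XDy: "weyl_X A m i \<odot>\<^bsub>M\<^esub> (weyl_D A m i \<odot>\<^bsub>M\<^esub> y) = \<ominus>\<^bsub>M\<^esub> y" if i: "i \<in> {1..m}" for i
    proof -
      note c = weyl_X_closed[OF ring_A i] weyl_D_closed[OF ring_A i]
      have "weyl_X A m i \<odot>\<^bsub>M\<^esub> y = \<zero>\<^bsub>M\<^esub>"
        using component_smult[OF weyl_X_component[OF ring_A i] y] trivial by (simp add: add.commute)
      then have "(weyl_D A m i \<otimes>\<^bsub>weyl_algebra A m\<^esub> weyl_X A m i) \<odot>\<^bsub>M\<^esub> y = \<zero>\<^bsub>M\<^esub>"
        using c yM by (simp add: smult_assoc smult_zero_right)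
      then have "weyl_X A m i \<odot>\<^bsub>M\<^esub> (weyl_D A m i \<odot>\<^bsub>M\<^esub> y) \<oplus>\<^bsub>M\<^esub> y = \<zero>\<^bsub>M\<^esub>"
        unfolding weyl_D_X_commute[OF ring_A i]
        using c yM by (simp add: smult_l_distr smult_assoc smult_one)
      then show ?thesis
        using c yM by (intro M.minus_equality[symmetric]) (auto simp: smult_closed)
    qed
    have "weyl_euler A m \<odot>\<^bsub>M\<^esub> y = (\<Oplus>\<^bsub>M\<^esub>i\<in>{1..m}. \<ominus>\<^bsub>M\<^esub> y)"
      unfolding euler_smult[OF yM] using yM by (intro M.finsum_cong') (auto simp: XDy)
    also have "\<dots> = [m] \<cdot>\<^bsub>M\<^esub> (\<ominus>\<^bsub>M\<^esub> y)"
      using yM by (simp add: M.add.finprod_const)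
    also have "\<dots> = [(- int m)] \<cdot>\<^bsub>M\<^esub> y"
      using yM M.add.int_pow_neg[of y "int m"] M.add.int_pow_inv[of y "int m"]
      by (simp add: add_pow_def a_inv_def int_pow_int)
    finally show "weyl_euler A m \<odot>\<^bsub>M\<^esub> y = [(- int m)] \<cdot>\<^bsub>M\<^esub> y" .
  qed (use assms(2) in simp)
  with assms(1) component_zero show False by blast
qed

text \<open>Going down from \<open>t\<close> stops at \<open>0\<close>, the last step starting at \<open>1\<close>; going up never
  starts at \<open>- m\<close>, which is negative.\<close>

lemma nonnegative_components_nontrivial:
  assumes "m \<ge> 1" "C t \<noteq> {\<zero>\<^bsub>M\<^esub>}" "t \<ge> 0" "n \<ge> 0"
  shows "C n \<noteq> {\<zero>\<^bsub>M\<^esub>}"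
proof (cases "n \<ge> t")
  case True
  then show ?thesis
  proof (induction n rule: int_ge_induct)
    case (step i)
    then show ?case using component_above_nontrivial[of i] assms(1,3) by simp
  qed (rule assms(2))
next
  case False
  then have "n \<le> t" by simp
  then show ?thesis using assms(4)
  proof (induction n rule: int_le_induct)
    case (step i)
    then show ?case using component_below_nontrivial[of i] by simp
  qed (rule assms(2))
qed

text \<open>The mirror image: going up stops at \<open>- m\<close>, and going down never starts at \<open>0\<close>.\<close>

lemma components_below_minus_m_nontrivial:
  assumes "m \<ge> 1" "C s \<noteq> {\<zero>\<^bsub>M\<^esub>}" "s \<le> - int m" "n \<le> - int m"
  shows "C n \<noteq> {\<zero>\<^bsub>M\<^esub>}"
proof (cases "n \<ge> s")
  case True
  then show ?thesis using assms(4)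
  proof (induction n rule: int_ge_induct)
    case (step i)
    then show ?case using component_above_nontrivial[of i] by simp
  qed (rule assms(2))
next
  case False
  then have "n \<le> s" by simp
  then show ?thesis
  proof (induction n rule: int_le_induct)
    case (step i)
    then show ?case using component_below_nontrivial[of i] assms(1,3) by simp
  qed (rule assms(2))
qed

end

end


section \<open>Half-lines and infinite sets of integers\<close>

lemma infinite_int_below:
  fixes P :: "int \<Rightarrow> bool"
  assumes "\<forall>n\<le>r. P n"
  shows "infinite {n. n < 0 \<and> P n}"
proof
  assume "finite {n. n < 0 \<and> P n}"
  moreover have "{..min r (- 1)} \<subseteq> {n. n < 0 \<and> P n}"
    using assms by (simp add: subset_iff)
  ultimately show False
    using infinite_Iic[of "min r (- 1)"] finite_subset by metis
qed

lemma infinite_int_above: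
  fixes P :: "int \<Rightarrow> bool"
  assumes "\<forall>n\<ge>s. P n"
  shows "infinite {n. n \<ge> 0 \<and> P n}"
proof
  assume "finite {n. n \<ge> 0 \<and> P n}"
  moreover have "{max s 0..} \<subseteq> {n. n \<ge> 0 \<and> P n}"
    using assms by (simp add: subset_iff)
  ultimately show False
    using infinite_Ici[of "max s 0"] finite_subset by metis
qed

lemma infinite_negative_int_unbounded:
  fixes P :: "int \<Rightarrow> bool"
  assumes "infinite {n. n < 0 \<and> P n}"
  shows "\<exists>n\<le>r. P n"
proof (rule ccontr)
  assume no: "\<not> ?thesis"
  have "{n. n < 0 \<and> P n} \<subseteq> {r..0}"
  proof
    fix n assume n: "n \<in> {n. n < 0 \<and> P n}"
    then have "\<not> n \<le> r" using no by auto
    with n show "n \<in> {r..0}" by simp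
  qed
  then have "finite {n. n < 0 \<and> P n}" by (rule finite_subset) simp
  with assms show False by (rule notE)
qed


section \<open>Nonvanishing of components on half-lines\<close>

theorem theorem7p1:
  fixes A :: "('a, 'x) ring_scheme" and K :: "'a set" and m :: nat
    and M :: "((weyl_letter list \<Rightarrow> 'a) set, 'b, 'y) module_scheme"
    and C :: "int \<Rightarrow> 'b set"
  assumes "cring A" and "noetherian_ring A"
    and "subfield K A"
    and char_zero: "\<forall>n::nat. n > 0 \<longrightarrow> add_pow (A\<lparr>carrier := K\<rparr>) n \<one>\<^bsub>A\<lparr>carrier := K\<rparr>\<^esub> \<noteq> \<zero>\<^bsub>A\<lparr>carrier := K\<rparr>\<^esub>"
    and "m \<ge> 1"
    and "generalized_eulerian A m M C"
  shows
    "((infinite {n. n < 0 \<and> C n \<noteq> {\<zero>\<^bsub>M\<^esub>}} \<longleftrightarrow> (\<exists>r. \<forall>n\<le>r. C n \<noteq> {\<zero>\<^bsub>M\<^esub>})) \<and>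
      ((\<exists>r. \<forall>n\<le>r. C n \<noteq> {\<zero>\<^bsub>M\<^esub>}) \<longleftrightarrow> (\<forall>n\<le>- int m. C n \<noteq> {\<zero>\<^bsub>M\<^esub>})) \<and>
      ((\<forall>n\<le>- int m. C n \<noteq> {\<zero>\<^bsub>M\<^esub>}) \<longleftrightarrow> (\<exists>s\<le>- int m. C s \<noteq> {\<zero>\<^bsub>M\<^esub>}))) \<and>
     ((infinite {n. n \<ge> 0 \<and> C n \<noteq> {\<zero>\<^bsub>M\<^esub>}} \<longleftrightarrow> (\<exists>s. \<forall>n\<ge>s. C n \<noteq> {\<zero>\<^bsub>M\<^esub>})) \<and>
      ((\<exists>s. \<forall>n\<ge>s. C n \<noteq> {\<zero>\<^bsub>M\<^esub>}) \<longleftrightarrow> (\<forall>n\<ge>0. C n \<noteq> {\<zero>\<^bsub>M\<^esub>})) \<and>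
      ((\<forall>n\<ge>0. C n \<noteq> {\<zero>\<^bsub>M\<^esub>}) \<longleftrightarrow> (\<exists>t\<ge>0. C t \<noteq> {\<zero>\<^bsub>M\<^esub>})))"
proof -
  interpret generalized_eulerian A m M C by fact
  let ?N = "\<lambda>n. C n \<noteq> {\<zero>\<^bsub>M\<^esub>}"
  have ring_A: "ring A" using \<open>cring A\<close> by (rule cring.axioms(1))
  have char_zero_A: "[n] \<cdot>\<^bsub>A\<^esub> \<one>\<^bsub>A\<^esub> \<noteq> \<zero>\<^bsub>A\<^esub>" if "n > 0" for n :: nat
    using char_zero that by (simp add: add_pow_def nat_pow_def)
  note below = components_below_minus_m_nontrivial[OF ring_A \<open>subfield K A\<close> char_zero_A \<open>m \<ge> 1\<close>]
  note above = nonnegative_components_nontrivial[OF ring_A \<open>subfield K A\<close> char_zero_A \<open>m \<ge> 1\<close>]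
  have I_ad: "\<exists>s\<le>- int m. ?N s" if "infinite {n. n < 0 \<and> ?N n}"
    using infinite_negative_int_unbounded[OF that] .
  have I_dc: "\<forall>n\<le>- int m. ?N n" if "\<exists>s\<le>- int m. ?N s"
    using that below by blast
  have I_cb: "\<exists>r. \<forall>n\<le>r. ?N n" if "\<forall>n\<le>- int m. ?N n"
    using that by (rule exI)
  have I_cd: "\<exists>s\<le>- int m. ?N s" if "\<forall>n\<le>- int m. ?N n"
    using that by (intro exI[of _ "- int m"]) simp
  have I_ba: "infinite {n. n < 0 \<and> ?N n}" if "\<exists>r. \<forall>n\<le>r. ?N n"
    using that infinite_int_below[of _ ?N] by blast
  have II_ad: "\<exists>t\<ge>0. ?N t" if "infinite {n. n \<ge> 0 \<and> ?N n}"
    using infinite_imp_nonempty[OF that] by blast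
  have II_dc: "\<forall>n\<ge>0. ?N n" if "\<exists>t\<ge>0. ?N t"
    using that above by blast
  have II_cb: "\<exists>s. \<forall>n\<ge>s. ?N n" if "\<forall>n\<ge>0. ?N n"
    using that by (rule exI)
  have II_cd: "\<exists>t\<ge>0. ?N t" if "\<forall>n\<ge>0. ?N n"
    using that by (intro exI[of _ 0]) simp
  have II_ba: "infinite {n. n \<ge> 0 \<and> ?N n}" if "\<exists>s. \<forall>n\<ge>s. ?N n"
    using that infinite_int_above[of _ ?N] by blast
  show ?thesis
    using I_ad I_dc I_cd I_cb I_ba II_ad II_dc II_cd II_cb II_ba by argo
qed

end
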